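(* Let $q=p^f$ be an odd prime power, where $p$ is an odd prime and $f$ is a positive integer, and let $s_1,s_2,\dots,s_{(q-1)/2}$ be an enumeration of all the non-zero squares of the finite field $\mathbb{F}_q$. Let $A_q(2)=\left[K_q(s_i+s_j)\right]_{1\le i,j\le (q-1)/2}$, where $K_q(b)$ denotes the Kloosterman sum over $\mathbb{F}_q$. Then the matrix $A_q(2)$ is singular whenever $q\ge 11$. In addition, $\det A_3(2)=2$, $\det A_5(2)=-5$, and $\det A_7(2)=49$.
   Context: Let $\zeta_p=e^{2\pi i/p}\in\mathbb{C}$, let $\mathbb{F}_q^{\times}=\mathbb{F}_q\setminus\{0\}$, and let $\mathrm{Tr}:\mathbb{F}_q\to\mathbb{F}_p$ be the trace map $\mathrm{Tr}(x)=x+x^p+\cdots+x^{p^{f-1}}$. For $b\in\mathbb{F}_q$ (including $b=0$), the Kloosterman sum is $$K_q(b)=\sum_{x\in\mathbb{F}_q^{\times}}\zeta_p^{\mathrm{Tr}\left(x+\frac{b}{x}\right)}\in\mathbb{C}.$$ The non-zero squares of $\mathbb{F}_q$ are the elements of $\{x^2: x\in\mathbb{F}_q^{\times}\}$, a set with $(q-1)/2$ elements. *)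

theory Defs
  imports
    Complex_Main
    "HOL-Library.Cardinality"
    "HOL-Computational_Algebra.Primes"
    "Jordan_Normal_Form.Determinant"
begin

text \<open>
  The finite field with \<open>q = p ^ f\<close> elements is a type \<open>'a :: {field, finite}\<close> with
  \<open>CARD('a) = p ^ f\<close>; the definitions below are meant to be used under this assumption,
  with \<open>p\<close> prime.
\<close>

definition zeta :: "nat \<Rightarrow> complex" where
  "zeta p = exp (2 * complex_of_real pi * \<i> / of_nat p)"

definition field_trace :: "nat \<Rightarrow> nat \<Rightarrow> 'a::{field, finite} \<Rightarrow> 'a" where
  "field_trace p f x = (\<Sum>i<f. x ^ (p ^ i))"

text \<open>
  The trace takes its values in the prime subfield, which is the bijective image of
  \<open>{..<p}\<close> under \<open>of_nat\<close>. The following function returns the representative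
  in \<open>{..<p}\<close>, so that \<open>zeta p\<close> can be raised to a power in the prime field
  (the result does not depend on the representative because \<open>zeta p ^ p = 1\<close>).
\<close>

definition prime_field_rep :: "nat \<Rightarrow> 'a::{field, finite} \<Rightarrow> nat" where
  "prime_field_rep p t = (THE k. k < p \<and> of_nat k = t)"

definition kloosterman :: "nat \<Rightarrow> nat \<Rightarrow> 'a::{field, finite} \<Rightarrow> complex" where
  "kloosterman p f b =
     (\<Sum>x\<in>UNIV - {0}. zeta p ^ prime_field_rep p (field_trace p f (x + b / x)))"

definition nonzero_squares :: "'a::{field, finite} set" where
  "nonzero_squares = {x ^ 2 | x. x \<noteq> 0}"

text \<open>Indices of matrices and enumerations start at 0.\<close>

definition kloosterman_mat :: "nat \<Rightarrow> nat \<Rightarrow> (nat \<Rightarrow> 'a::{field, finite}) \<Rightarrow> complex mat" where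
  "kloosterman_mat p f s =
     (let m = (p ^ f - 1) div 2 in mat m m (\<lambda>(i, j). kloosterman p f (s i + s j)))"

end

theory Submission
  imports Defs
begin

text \<open>
  Let \<open>\<psi>\<close> be the character \<open>x \<mapsto> \<zeta>\<^sub>p ^ Tr x\<close> and \<open>\<epsilon> = \<plusminus>1\<close> the value of the
  quadratic character at \<open>-1\<close>. For nonzero \<open>x\<close>, \<open>y\<close> there is an addition formula
  (\<open>kloosterman_sum_add_squares\<close>)

    \<open>K (x\<^sup>2 + y\<^sup>2) = \<epsilon> * (\<Sum>(a, b) with a\<^sup>2 + b\<^sup>2 = 4. \<psi> (a * x) * \<psi> (b * y))\<close>.

  It holds because both sides are combinations of the values \<open>\<psi> z\<close> whose coefficients count the
  roots of a quadratic equation, and the discriminants of the two equations are negatives of each other up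
  to a square factor.

  In the formula the variables \<open>x\<close> and \<open>y\<close> are separated. The matrix entry at the squares
  \<open>x\<^sup>2\<close> and \<open>y\<^sup>2\<close> is therefore a sum, over the values \<open>\<alpha>\<close> that \<open>a\<^sup>2\<close> takes
  on the circle \<open>a\<^sup>2 + b\<^sup>2 = 4\<close>, of a function of \<open>x\<close> times a function of \<open>y\<close>. So
  the rank is at most the number of these \<open>\<alpha>\<close>. The circle has at most \<open>q + 1\<close> points and, by
  changes of sign, essentially four of them share the same \<open>\<alpha>\<close>. This bounds the rank by
  \<open>(q + 5) / 4\<close> (\<open>card_squared_abscissae_le\<close>), which is less than the size
  \<open>(q - 1) / 2\<close> of the matrix when \<open>q \<ge> 11\<close>.

  For \<open>q = 3, 5, 7\<close> the field is the field of integers modulo \<open>q\<close> and the entries are explicit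
  polynomials in \<open>\<zeta>\<^sub>q\<close>. The determinants follow from
  \<open>1 + \<zeta>\<^sub>q + \<dots> + \<zeta>\<^sub>q ^ (q - 1) = 0\<close>; they do not depend on the enumeration of the squares, since
  another enumeration permutes rows and columns in the same way.
\<close>

section \<open>Square roots and quadratic equations over a finite field\<close>

definition square_roots :: "'a::{field, finite} \<Rightarrow> 'a set" where
  "square_roots d = {r. r ^ 2 = d}"

lemma four_nonzero:
  assumes "(2::'a::field) \<noteq> 0"
  shows "(4::'a) \<noteq> 0"
proof -
  have "(4::'a) = 2 * 2" by simp
  then show ?thesis using assms by (metis no_zero_divisors)
qed

lemma square_roots_eq_pair: "r ^ 2 = d \<Longrightarrow> square_roots d = {r, - r}"
  by (auto simp: square_roots_def power2_eq_iff)

lemma card_square_roots_le: "card (square_roots d) \<le> 2"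
proof (cases "square_roots d = {}")
  case False
  then obtain r where "r ^ 2 = d" by (auto simp: square_roots_def)
  from square_roots_eq_pair[OF this] show ?thesis
    by (simp add: card_insert_if)
qed simp

lemma card_square_roots_0 [simp]: "card (square_roots 0) = 1"
  by (simp add: square_roots_def)

lemma card_square_roots_square:
  fixes r :: "'a::{field, finite}"
  assumes "(2::'a) \<noteq> 0" "r \<noteq> 0"
  shows "card (square_roots (r ^ 2)) = 2"
proof -
  have "r + r \<noteq> 0"
    using assms by (metis mult_2 no_zero_divisors)
  then have "r \<noteq> - r"
    by (metis add_eq_0_iff)
  then show ?thesis
    by (simp add: square_roots_eq_pair[OF refl])
qed

lemma card_square_roots_eq_2:
  fixes d :: "'a::{field, finite}"
  assumes "(2::'a) \<noteq> 0" "d \<noteq> 0" "square_roots d \<noteq> {}"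
  shows "card (square_roots d) = 2"
  using assms card_square_roots_square by (fastforce simp: square_roots_def)

lemma card_square_roots_scale:
  assumes "k \<noteq> 0"
  shows "card (square_roots (k ^ 2 * d)) = card (square_roots d)"
proof (rule bij_betw_same_card)
  show "bij_betw (\<lambda>r. r / k) (square_roots (k ^ 2 * d)) (square_roots d)"
    by (rule bij_betwI[where g = "\<lambda>r. r * k"])
      (use assms in \<open>auto simp: square_roots_def power_mult_distrib power_divide\<close>)
qed

lemma card_quadratic_roots:
  fixes a b c :: "'a::{field, finite}"
  assumes two: "(2::'a) \<noteq> 0" and "a \<noteq> 0"
  shows "card {t. a * t ^ 2 + b * t + c = 0} = card (square_roots (b ^ 2 - 4 * a * c))"
proof (rule bij_betw_same_card)
  note four = four_nonzero[OF two]
  have square: "(2 * a * t + b) ^ 2 - (b ^ 2 - 4 * a * c) = 4 * a * (a * t ^ 2 + b * t + c)" for t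
    by (simp add: power2_eq_square algebra_simps)
  have iff: "(2 * a * t + b) ^ 2 = b ^ 2 - 4 * a * c \<longleftrightarrow> a * t ^ 2 + b * t + c = 0" for t
    using square[of t] four assms by (metis eq_iff_diff_eq_0 mult_eq_0_iff)
  show "bij_betw (\<lambda>t. 2 * a * t + b) {t. a * t ^ 2 + b * t + c = 0}
      (square_roots (b ^ 2 - 4 * a * c))"
  proof (rule bij_betwI[where g = "\<lambda>r. (r - b) / (2 * a)"])
    show "(\<lambda>r. (r - b) / (2 * a)) \<in> square_roots (b ^ 2 - 4 * a * c)
        \<rightarrow> {t. a * t ^ 2 + b * t + c = 0}"
      using assms by (auto simp: square_roots_def iff[symmetric])
  qed (use assms in \<open>auto simp: square_roots_def iff\<close>)
qed

lemma sum_card_square_roots: "(\<Sum>d\<in>UNIV. card (square_roots (d::'a::{field, finite}))) = CARD('a)"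
proof -
  have "card (UNIV :: 'a set) = (\<Sum>r::'a\<in>UNIV. 1)" by simp
  also have "\<dots> = (\<Sum>d::'a\<in>UNIV. \<Sum>r | r \<in> UNIV \<and> r ^ 2 = d. 1)"
    by (rule sum.group[symmetric]) auto
  finally show ?thesis by (simp add: square_roots_def)
qed

text \<open>
  The sum of the left-hand side over all \<open>d\<close> is \<open>2 * CARD('a)\<close>. No term exceeds 2: if
  \<open>d \<noteq> 0\<close> and \<open>- d\<close> were both squares, their quotient \<open>-1\<close> would be one.
  So every term is exactly 2.
\<close>
lemma card_square_roots_minus:
  fixes d :: "'a::{field, finite}"
  assumes two: "(2::'a) \<noteq> 0" and nonsquare: "square_roots (-1::'a) = {}"
  shows "card (square_roots d) + card (square_roots (- d)) = 2"
proof -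
  let ?w = "\<lambda>d::'a. card (square_roots d)"
  have le: "?w e + ?w (- e) \<le> 2" for e
  proof (rule ccontr)
    assume gt: "\<not> ?thesis"
    then have "e \<noteq> 0" by auto
    moreover have "square_roots e \<noteq> {}" "square_roots (- e) \<noteq> {}"
      using gt card_square_roots_le[of e] card_square_roots_le[of "- e"] by auto
    then obtain r s where rs: "r ^ 2 = e" "s ^ 2 = - e" by (auto simp: square_roots_def)
    ultimately have "(s / r) ^ 2 = -1"
      by (simp add: power_divide)
    then show False using nonsquare by (auto simp: square_roots_def)
  qed
  have "(\<Sum>e\<in>UNIV. ?w (- e)) = (\<Sum>e\<in>UNIV. ?w e)"
    by (rule sum.reindex_bij_witness[of _ uminus uminus]) auto
  then have "(\<Sum>e\<in>UNIV. ?w e + ?w (- e)) = (\<Sum>e::'a\<in>UNIV. 2)"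
    by (simp add: sum.distrib sum_card_square_roots)
  then show ?thesis
    using sum_mono_inv[of "\<lambda>e. ?w e + ?w (- e)" UNIV "\<lambda>_. 2" d] le by simp
qed

text \<open>
  In terms of the quadratic character \<open>\<eta>\<close>, the number of square roots of \<open>d\<close> is
  \<open>1 + \<eta> d\<close>, and the identity says \<open>\<eta> (- d) = \<eta> (-1) * \<eta> d\<close>.
\<close>
lemma card_square_roots_uminus_sign:
  assumes two: "(2::'a::{field, finite}) \<noteq> 0"
  obtains \<epsilon> :: complex where "\<epsilon> ^ 2 = 1"
    "\<And>d::'a. of_nat (card (square_roots (- d))) - 1 = \<epsilon> * (of_nat (card (square_roots d)) - 1)"
proof (cases "square_roots (-1::'a) = {}")
  case True
  have "of_nat (card (square_roots (- d))) - 1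
      = (-1) * (of_nat (card (square_roots d)) - 1 :: complex)" for d :: 'a
    using arg_cong[OF card_square_roots_minus[OF two True, of d], of "of_nat :: nat \<Rightarrow> complex"]
    by (simp add: algebra_simps eq_diff_eq)
  then show ?thesis using that[of "-1"] by simp
next
  case False
  then obtain i :: 'a where i: "i ^ 2 = -1" by (auto simp: square_roots_def)
  then have "i \<noteq> 0" by auto
  from card_square_roots_scale[OF this] i show ?thesis using that[of 1] by simp
qed

section \<open>The circle of radius 2\<close>

definition circle :: "('a::{field, finite} \<times> 'a) set" where
  "circle = {(a, b). a ^ 2 + b ^ 2 = 4}"

text \<open>
  The values of \<open>a\<^sup>2\<close> on the circle. Their number bounds the rank of the Kloosterman matrix.
\<close>
definition squared_abscissae :: "'a::{field, finite} set" where
  "squared_abscissae = {\<alpha>. square_roots \<alpha> \<noteq> {} \<and> square_roots (4 - \<alpha>) \<noteq> {}}"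

lemma sum_circle:
  fixes h :: "'a::{field, finite} \<Rightarrow> 'a \<Rightarrow> 'b::comm_monoid_add"
  shows "(\<Sum>(a, b)\<in>circle. h a b)
    = (\<Sum>\<alpha>\<in>squared_abscissae. \<Sum>a\<in>square_roots \<alpha>. \<Sum>b\<in>square_roots (4 - \<alpha>). h a b)"
proof -
  have "(\<Sum>(a, b)\<in>circle. h a b)
      = (\<Sum>\<alpha>\<in>squared_abscissae. \<Sum>(a, b) | (a, b) \<in> circle \<and> a ^ 2 = \<alpha>. h a b)"
    unfolding case_prod_beta prod.collapse
    by (rule sum.group[symmetric])
      (auto simp: circle_def squared_abscissae_def square_roots_def eq_diff_eq add.commute)
  also have "\<dots> = (\<Sum>\<alpha>\<in>squared_abscissae. \<Sum>(a, b)\<in>square_roots \<alpha> \<times> square_roots (4 - \<alpha>). h a b)"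
    by (intro sum.cong refl) (auto simp: circle_def square_roots_def eq_diff_eq add.commute)
  finally show ?thesis by (simp add: sum.cartesian_product)
qed

text \<open>
  The slope of the line to the point \<open>(2, 0)\<close> determines every other point of the circle
  (stereographic projection).
\<close>
lemma card_circle_le:
  assumes two: "(2::'a::{field, finite}) \<noteq> 0"
  shows "card (circle :: ('a \<times> 'a) set) \<le> CARD('a) + 1"
proof -
  let ?C = "circle - {(2, 0)} :: ('a \<times> 'a) set"
  have "inj_on (\<lambda>(a, b). b / (a - 2)) ?C"
  proof (rule inj_onI)
    fix u u' :: "'a \<times> 'a"
    obtain a b a' b' where u: "u = (a, b)" and u': "u' = (a', b')" by (metis surj_pair)
    assume "u \<in> ?C" "u' \<in> ?C" "(case u of (a, b) \<Rightarrow> b / (a - 2)) = (case u' of (a, b) \<Rightarrow> b / (a - 2))"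
    then have C: "(a, b) \<in> ?C" "(a', b') \<in> ?C" and eq: "b / (a - 2) = b' / (a' - 2)"
      by (simp_all add: u u')
    have key: "u \<noteq> 2 \<and> u * (1 + (v / (u - 2)) ^ 2) = 2 * (v / (u - 2)) ^ 2 - 2"
      if "(u, v) \<in> ?C" for u v
    proof -
      have uv: "u ^ 2 + v ^ 2 = 4" and ne: "u \<noteq> 2 \<or> v \<noteq> 0"
        using that by (auto simp: circle_def)
      have "u \<noteq> 2" using uv ne by auto
      define t where "t = v / (u - 2)"
      have v: "v = t * (u - 2)" using \<open>u \<noteq> 2\<close> by (simp add: t_def)
      \<comment> \<open>The quadratic equation for \<open>u\<close> on the line of slope \<open>t\<close>, with the known root 2 split off.\<close>
      have "(u - 2) * (u * (1 + t ^ 2) - (2 * t ^ 2 - 2)) = u ^ 2 + v ^ 2 - 4"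
        unfolding v by (simp add: power2_eq_square algebra_simps)
      then have "u * (1 + t ^ 2) = 2 * t ^ 2 - 2" using uv \<open>u \<noteq> 2\<close> by simp
      then show ?thesis using \<open>u \<noteq> 2\<close> by (simp add: t_def)
    qed
    define t where "t = b / (a - 2)"
    have t: "a * (1 + t ^ 2) = 2 * t ^ 2 - 2" "a' * (1 + t ^ 2) = 2 * t ^ 2 - 2"
      using key[OF C(1)] key[OF C(2)] eq by (simp_all add: t_def)
    have "1 + t ^ 2 \<noteq> 0"
    proof
      assume 0: "1 + t ^ 2 = 0"
      then have "t ^ 2 = -1" by (metis add_eq_0_iff)
      then have "(4::'a) = 0" using t(1) by simp
      then show False using four_nonzero[OF two] by simp
    qed
    then have "a = a'" using t by (metis mult_right_cancel)
    moreover have "b = b'"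
      using eq key[OF C(1)] key[OF C(2)] \<open>a = a'\<close> by simp
    ultimately show "u = u'" by (simp add: u u')
  qed
  then have "card ?C \<le> CARD('a)"
    by (rule card_inj_on_le) auto
  moreover have "card (circle :: ('a \<times> 'a) set) \<le> card (insert (2, 0) ?C)"
    by (rule card_mono) auto
  moreover have "card (insert (2, 0) ?C) = card ?C + 1"
    by (subst card_insert_disjoint) auto
  ultimately show ?thesis by simp
qed

text \<open>
  Sign changes of the two coordinates give four points of the circle above each \<open>\<alpha>\<close>, except
  above \<open>0\<close> and \<open>4\<close>, where one of the coordinates vanishes and two points are left.
\<close>
lemma card_squared_abscissae_le:
  assumes two: "(2::'a::{field, finite}) \<noteq> 0"
  shows "4 * card (squared_abscissae :: 'a set) \<le> CARD('a) + 5"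
proof -
  let ?S = "squared_abscissae :: 'a set" and ?w = "\<lambda>d::'a. card (square_roots d)"
  note four = four_nonzero[OF two]
  \<comment> \<open>A correction of 2 at the two exceptional values gives every \<open>\<alpha>\<close> weight at least 4.\<close>
  have "4 \<le> ?w \<alpha> * ?w (4 - \<alpha>) + (if \<alpha> \<in> {0, 4} then 2 else 0)" if "\<alpha> \<in> ?S" for \<alpha>
  proof -
    have "\<alpha> = 0 \<or> ?w \<alpha> = 2" "\<alpha> = 4 \<or> ?w (4 - \<alpha>) = 2"
      using that card_square_roots_eq_2[OF two, of \<alpha>] card_square_roots_eq_2[OF two, of "4 - \<alpha>"]
      by (auto simp: squared_abscissae_def)
    then show ?thesis using four by auto
  qed
  then have "(\<Sum>\<alpha>\<in>?S. 4) \<le> (\<Sum>\<alpha>\<in>?S. ?w \<alpha> * ?w (4 - \<alpha>) + (if \<alpha> \<in> {0, 4} then 2 else 0))"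
    by (rule sum_mono)
  also have "\<dots> = (\<Sum>\<alpha>\<in>?S. ?w \<alpha> * ?w (4 - \<alpha>)) + (\<Sum>\<alpha>\<in>?S \<inter> {0, 4}. 2)"
    unfolding sum.distrib by (simp only: sum.inter_restrict[OF finite])
  also have "(\<Sum>\<alpha>\<in>?S. ?w \<alpha> * ?w (4 - \<alpha>)) = card (circle :: ('a \<times> 'a) set)"
    using sum_circle[of "\<lambda>(_::'a) (_::'a). 1 :: nat"] by (simp add: case_prod_beta)
  also have "(\<Sum>\<alpha>\<in>?S \<inter> {0, 4}. 2) \<le> (4::nat)"
    using card_mono[of "{0, 4::'a}" "?S \<inter> {0, 4}"] card_insert_le_m1[of 2 "{4::'a}" 0] by simp
  finally show ?thesis using card_circle_le[OF two] by simp
qed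

text \<open>
  Eliminating \<open>a\<close> leaves a quadratic equation for \<open>b\<close> whose discriminant is
  \<open>(2 * x)\<^sup>2 * (4 * (x\<^sup>2 + y\<^sup>2) - z\<^sup>2)\<close>. When the leading coefficient \<open>x\<^sup>2 + y\<^sup>2\<close>
  vanishes, the equation is linear and one solution is lost for every \<open>z\<close>; since this loss does
  not depend on \<open>z\<close>, it has no effect on sums against a nontrivial character.
\<close>
lemma card_circle_line:
  fixes x y z :: "'a::{field, finite}"
  assumes two: "(2::'a) \<noteq> 0" and x: "x \<noteq> 0" and y: "y \<noteq> 0"
  shows "of_nat (card {(a, b) \<in> circle. a * x + b * y = z})
    = (of_nat (card (square_roots (4 * (x ^ 2 + y ^ 2) - z ^ 2))) - of_bool (x ^ 2 + y ^ 2 = 0) :: complex)"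
proof -
  define n where "n = x ^ 2 + y ^ 2"
  let ?B = "{b. n * b ^ 2 + (- 2 * z * y) * b + (z ^ 2 - 4 * x ^ 2) = 0}"
  have "bij_betw (\<lambda>(a, b). b) {(a, b) \<in> circle. a * x + b * y = z} ?B"
  proof (rule bij_betwI[where g = "\<lambda>b. ((z - b * y) / x, b)"])
    have id: "n * b ^ 2 + (- 2 * z * y) * b + (z ^ 2 - 4 * x ^ 2)
        = (z - b * y) ^ 2 + x ^ 2 * b ^ 2 - 4 * x ^ 2" for b
      by (simp add: n_def power2_eq_square algebra_simps)
    show "(\<lambda>(a, b). b) \<in> {(a, b) \<in> circle. a * x + b * y = z} \<rightarrow> ?B"
    proof clarify
      fix a b assume ab: "(a, b) \<in> circle" and z: "z = a * x + b * y"
      have "(z - b * y) ^ 2 + x ^ 2 * b ^ 2 - 4 * x ^ 2 = x ^ 2 * (a ^ 2 + b ^ 2 - 4)"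
        unfolding z by (simp add: power2_eq_square algebra_simps)
      then show "n * b ^ 2 + (- 2 * (a * x + b * y) * y) * b + ((a * x + b * y) ^ 2 - 4 * x ^ 2) = 0"
        using ab id[of b] unfolding z by (simp add: circle_def)
    qed
    show "(\<lambda>b. ((z - b * y) / x, b)) \<in> ?B \<rightarrow> {(a, b) \<in> circle. a * x + b * y = z}"
    proof
      fix b assume "b \<in> ?B"
      then have "(z - b * y) ^ 2 + x ^ 2 * b ^ 2 - 4 * x ^ 2 = 0" using id[of b] by simp
      then have "((z - b * y) / x) ^ 2 + b ^ 2 = 4"
        using x by (simp add: power_divide divide_simps) (simp add: algebra_simps)
      then show "((z - b * y) / x, b) \<in> {(a, b) \<in> circle. a * x + b * y = z}"
        using x by (simp add: circle_def)
    qed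
  qed (use x in auto)
  then have card: "card {(a, b) \<in> circle. a * x + b * y = z} = card ?B"
    by (rule bij_betw_same_card)
  note four = four_nonzero[OF two]
  show ?thesis
  proof (cases "n = 0")
    case False
    have "(- 2 * z * y) ^ 2 - 4 * n * (z ^ 2 - 4 * x ^ 2) = (2 * x) ^ 2 * (4 * n - z ^ 2)"
      by (simp add: n_def power2_eq_square algebra_simps)
    then have "card ?B = card (square_roots (4 * n - z ^ 2))"
      using card_quadratic_roots[OF two False, of "- 2 * z * y" "z ^ 2 - 4 * x ^ 2"]
        card_square_roots_scale[of "2 * x"] two x by simp
    then show ?thesis using card False by (simp add: n_def)
  next
    case True
    have "(y / x) ^ 2 = - 1"
      using True x unfolding n_def by (simp add: power_divide add_eq_0_iff)
    then have minus: "card (square_roots (- (z ^ 2))) = card (square_roots (z ^ 2))"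
      using card_square_roots_scale[of "y / x" "z ^ 2"] x y by simp
    show ?thesis
    proof (cases "z = 0")
      case True': True
      then have "?B = {}" using True x four by auto
      then show ?thesis using card True True' by (simp add: n_def)
    next
      case nz: False
      have "?B = {(z ^ 2 - 4 * x ^ 2) / (2 * z * y)}"
        using True nz two y by (auto simp: field_simps)
      then show ?thesis
        using card True minus card_square_roots_square[OF two nz] by (simp add: n_def)
    qed
  qed
qed

section \<open>Kloosterman sums at sums of two squares\<close>

locale additive_character =
  fixes \<psi> :: "'a::{field, finite} \<Rightarrow> complex"
  assumes add: "\<psi> (x + y) = \<psi> x * \<psi> y"
    and zero: "\<psi> 0 = 1"
    and nontrivial: "\<exists>x. \<psi> x \<noteq> 1"
begin

lemma sum_UNIV_eq_0: "(\<Sum>x\<in>UNIV. \<psi> x) = 0"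
proof -
  obtain c where c: "\<psi> c \<noteq> 1" using nontrivial by blast
  have "(\<Sum>x\<in>UNIV. \<psi> x) = (\<Sum>x\<in>UNIV. \<psi> (c + x))"
    by (rule sum.reindex_bij_witness[of _ "\<lambda>x. c + x" "\<lambda>x. x - c"]) auto
  also have "\<dots> = \<psi> c * (\<Sum>x\<in>UNIV. \<psi> x)" by (simp add: add sum_distrib_left)
  finally show ?thesis using c by simp
qed

lemma sum_shift_weights: "(\<Sum>z\<in>UNIV. \<psi> z * (w z - c)) = (\<Sum>z\<in>UNIV. \<psi> z * w z)"
  using sum_UNIV_eq_0
  by (simp add: right_diff_distrib sum_subtractf flip: sum_distrib_right)

lemma sum_by_value:
  assumes "finite A"
  shows "(\<Sum>t\<in>A. \<psi> (g t)) = (\<Sum>z\<in>UNIV. \<psi> z * of_nat (card {t\<in>A. g t = z}))"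
proof -
  have "(\<Sum>t\<in>A. \<psi> (g t)) = (\<Sum>z\<in>UNIV. \<Sum>t | t \<in> A \<and> g t = z. \<psi> (g t))"
    by (rule sum.group[symmetric]) (use assms in auto)
  also have "\<dots> = (\<Sum>z\<in>UNIV. \<Sum>t | t \<in> A \<and> g t = z. \<psi> z)"
    by (intro sum.cong) auto
  finally show ?thesis by (simp add: mult.commute)
qed

definition kloosterman_sum :: "'a \<Rightarrow> complex" where
  "kloosterman_sum b = (\<Sum>x\<in>UNIV - {0}. \<psi> (x + b / x))"

text \<open>
  For \<open>n \<noteq> 0\<close>, \<open>x + n / x = z\<close> is a quadratic equation for \<open>x\<close> with discriminant
  \<open>z\<^sup>2 - 4 * n\<close>. For \<open>n = 0\<close> the counts differ by the constant 1, which
  the character sum annihilates.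
\<close>
lemma kloosterman_sum_eq_sum_square_roots:
  assumes two: "(2::'a) \<noteq> 0"
  shows "kloosterman_sum n = (\<Sum>z\<in>UNIV. \<psi> z * of_nat (card (square_roots (z ^ 2 - 4 * n))))"
proof (cases "n = 0")
  case False
  have "card {t \<in> UNIV - {0}. t + n / t = z} = card (square_roots (z ^ 2 - 4 * n))" for z
  proof -
    have "t \<noteq> 0 \<and> t + n / t = z \<longleftrightarrow> 1 * t ^ 2 + (- z) * t + n = 0" for t
    proof (cases "t = 0")
      case nz: False
      have "1 * t ^ 2 + (- z) * t + n = t * (t + n / t - z)"
        using nz by (simp add: power2_eq_square algebra_simps)
      then show ?thesis using nz by simp
    qed (use False in simp)
    then have "{t \<in> UNIV - {0}. t + n / t = z} = {t. 1 * t ^ 2 + (- z) * t + n = 0}"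
      by simp
    then show ?thesis
      using card_quadratic_roots[OF two, of 1 "- z" n] by simp
  qed
  then show ?thesis unfolding kloosterman_sum_def by (subst sum_by_value) simp_all
next
  case True
  have "kloosterman_sum n = (\<Sum>z\<in>UNIV. \<psi> z * (if z = 0 then 0 else 1))"
    unfolding kloosterman_sum_def True by (rule sum.mono_neutral_cong_left) auto
  also have "\<dots> = (\<Sum>z\<in>UNIV. \<psi> z * (of_nat (card (square_roots (z ^ 2))) - 1))"
    by (intro sum.cong refl) (simp add: card_square_roots_square[OF two])
  finally show ?thesis by (simp add: sum_shift_weights True)
qed

text \<open>
  The finite analogue of the fact that the Bessel function \<open>J\<^sub>0 (\<bar>\<xi>\<bar>)\<close> is the Fourier transform of
  a circle. Sorting both sides by the value at which \<open>\<psi>\<close> is taken, the left-hand side has the weights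
  \<open>1 + \<eta> (z\<^sup>2 - 4 * n)\<close> and the right-hand side, up to a constant, the weights
  \<open>1 + \<eta> (4 * n - z\<^sup>2)\<close>, where \<open>n = x\<^sup>2 + y\<^sup>2\<close> and \<open>\<eta>\<close> is the quadratic
  character. Apart from the constant 1, which the character sum annihilates, they agree up to the
  sign \<open>\<epsilon> = \<eta> (-1)\<close>.
\<close>
lemma kloosterman_sum_add_squares:
  assumes two: "(2::'a) \<noteq> 0"
  obtains \<epsilon> where "\<And>x y. x \<noteq> 0 \<Longrightarrow> y \<noteq> 0 \<Longrightarrow>
    kloosterman_sum (x ^ 2 + y ^ 2) = \<epsilon> * (\<Sum>(a, b)\<in>circle. \<psi> (a * x) * \<psi> (b * y))"
proof -
  \<comment> \<open>The sign is \<open>\<eta> (-1)\<close>; being its own inverse, it can be moved to the other side at the end.\<close>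
  obtain \<epsilon> :: complex where \<epsilon>: "\<epsilon> ^ 2 = 1" and
    sign: "\<And>d::'a. of_nat (card (square_roots (- d))) - 1 = \<epsilon> * (of_nat (card (square_roots d)) - 1)"
    using card_square_roots_uminus_sign[OF two] by blast
  have "kloosterman_sum (x ^ 2 + y ^ 2) = \<epsilon> * (\<Sum>(a, b)\<in>circle. \<psi> (a * x) * \<psi> (b * y))"
    if x: "x \<noteq> 0" and y: "y \<noteq> 0" for x y
  proof -
    define n where "n = x ^ 2 + y ^ 2"
    let ?w = "\<lambda>d::'a. of_nat (card (square_roots d)) :: complex"
    have "(\<Sum>(a, b)\<in>circle. \<psi> (a * x) * \<psi> (b * y)) = (\<Sum>u\<in>circle. \<psi> (fst u * x + snd u * y))"
      by (simp add: add case_prod_beta)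
    also have "\<dots> = (\<Sum>z\<in>UNIV. \<psi> z * of_nat (card {u \<in> circle. fst u * x + snd u * y = z}))"
      by (rule sum_by_value) simp
    also have "\<dots> = (\<Sum>z\<in>UNIV. \<psi> z * (?w (4 * n - z ^ 2) - of_bool (n = 0)))"
      unfolding n_def card_circle_line[OF two x y, symmetric]
      by (intro sum.cong arg_cong2[of _ _ _ _ "(*)"] arg_cong[of _ _ "\<lambda>A. of_nat (card A)"]) auto
    also have "\<dots> = (\<Sum>z\<in>UNIV. \<psi> z * (?w (- (z ^ 2 - 4 * n)) - 1))"
      by (simp add: sum_shift_weights)
    also have "\<dots> = \<epsilon> * (\<Sum>z\<in>UNIV. \<psi> z * (?w (z ^ 2 - 4 * n) - 1))"
      unfolding sign by (simp add: sum_distrib_left mult.left_commute)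
    also have "\<dots> = \<epsilon> * kloosterman_sum n"
      by (simp add: sum_shift_weights kloosterman_sum_eq_sum_square_roots[OF two])
    finally show ?thesis
      using \<epsilon> by (simp add: n_def power2_eq_square flip: mult.assoc)
  qed
  then show thesis by (rule that)
qed

end

section \<open>Matrices of small rank\<close>

text \<open>
  Such a matrix has rank at most \<open>card S\<close>. It is the product of an \<open>n \<times> card S\<close> and a
  \<open>card S \<times> n\<close> matrix; padding both with zeros to \<open>n \<times> n\<close> matrices
  gives the second one a zero row.
\<close>
lemma singular_if_sum_of_few_products:
  fixes g h :: "'i \<Rightarrow> nat \<Rightarrow> complex"
  assumes fin: "finite S" and few: "card S < n"
    and A: "A = mat n n (\<lambda>(i, j). \<Sum>\<alpha>\<in>S. g \<alpha> i * h \<alpha> j)"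
  shows "\<not> invertible_mat A"
proof
  assume inv: "invertible_mat A"
  obtain e where e: "bij_betw e {0..<card S} S"
    using ex_bij_betw_nat_finite[OF fin] by blast
  define B where "B = mat n n (\<lambda>(i, k). if k < card S then g (e k) i else 0)"
  define C where "C = mat n n (\<lambda>(k, j). if k < card S then h (e k) j else 0)"
  have BC: "B \<in> carrier_mat n n" "C \<in> carrier_mat n n" by (simp_all add: B_def C_def)
  have "A = B * C"
  proof (rule eq_matI)
    fix i j assume "i < dim_row (B * C)" "j < dim_col (B * C)"
    then have ij: "i < n" "j < n" by (simp_all add: B_def C_def)
    have "(B * C) $$ (i, j)
        = (\<Sum>k\<in>{0..<n}. (if k < card S then g (e k) i else 0) * (if k < card S then h (e k) j else 0))"
      using ij by (simp add: B_def C_def scalar_prod_def)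
    also have "\<dots> = (\<Sum>k\<in>{0..<card S}. g (e k) i * h (e k) j)"
      by (rule sum.mono_neutral_cong_right) (use few in auto)
    also have "\<dots> = (\<Sum>\<alpha>\<in>S. g \<alpha> i * h \<alpha> j)"
      by (rule sum.reindex_bij_betw[OF e])
    finally show "A $$ (i, j) = (B * C) $$ (i, j)" using ij by (simp add: A)
  qed (simp_all add: A B_def C_def)
  moreover have "det C = 0"
  proof -
    have "C = mat\<^sub>r n n (\<lambda>k. if k = card S then 0\<^sub>v n else row C k)"
      using few by (intro eq_matI) (auto simp: C_def)
    then show ?thesis
      using det_row_0[OF few, of "row C"] by (simp add: C_def Pi_def row_def)
  qed
  ultimately have "det A = 0" using det_mult[OF BC] by simp
  have carrier: "A \<in> carrier_mat n n" by (simp add: A)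
  obtain A' where A': "A * A' = 1\<^sub>m (dim_row A)" "A' * A = 1\<^sub>m (dim_row A')"
    using inv by (auto simp: invertible_mat_def inverts_mat_def)
  have "dim_col A' = n" "dim_row A' = n"
    using arg_cong[OF A'(1), of dim_col] arg_cong[OF A'(2), of dim_col] by (simp_all add: A)
  then have "A' \<in> carrier_mat n n" by auto
  then have "det A * det A' = 1"
    using A'(1) carrier by (metis carrier_matD(1) det_mult det_one)
  with \<open>det A = 0\<close> show False by simp
qed

section \<open>The trace character of a finite field\<close>

lemma CHAR_eq_of_card_prime_power:
  assumes p: "prime p" and card: "CARD('a::{field, finite}) = p ^ f"
  shows "CHAR('a) = p"
proof -
  have "(\<Sum>x::'a\<in>UNIV. x) = (\<Sum>x\<in>UNIV. x + 1)"
    by (rule sum.reindex_bij_witness[of _ "\<lambda>x. x + 1" "\<lambda>x. x - 1"]) auto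
  then have "of_nat CARD('a) = (0::'a)" by (simp add: sum.distrib)
  then have "(of_nat p :: 'a) = 0" by (simp add: card)
  then have "CHAR('a) dvd p" by (simp add: of_nat_eq_0_iff_char_dvd)
  then show ?thesis using p by (auto simp: prime_nat_iff)
qed

text \<open>
  The inner binomial coefficients are divisible by the characteristic.
\<close>
lemma freshmans_dream:
  fixes x y :: "'a::comm_ring_1"
  assumes p: "prime CHAR('a)"
  shows "(x + y) ^ CHAR('a) = x ^ CHAR('a) + y ^ CHAR('a)"
proof -
  let ?p = "CHAR('a)"
  have p0: "?p \<noteq> 0" using p by auto
  have "(x + y) ^ ?p = (\<Sum>k\<le>?p. of_nat (?p choose k) * x ^ k * y ^ (?p - k))"
    by (rule binomial_ring)
  also have "\<dots> = (\<Sum>k\<in>{0, ?p}. of_nat (?p choose k) * x ^ k * y ^ (?p - k))"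
  proof (rule sum.mono_neutral_right)
    show "\<forall>k\<in>{..?p} - {0, ?p}. of_nat (?p choose k) * x ^ k * y ^ (?p - k) = 0"
    proof
      fix k assume "k \<in> {..?p} - {0, ?p}"
      then have "?p dvd (?p choose k)" using p by (intro dvd_choose_prime) auto
      then have "of_nat (?p choose k) = (0::'a)" by (simp add: of_nat_eq_0_iff_char_dvd)
      then show "of_nat (?p choose k) * x ^ k * y ^ (?p - k) = 0" by simp
    qed
  qed auto
  finally show ?thesis using p0 by (simp add: add.commute)
qed

text \<open>
  Multiplication by \<open>x \<noteq> 0\<close> permutes the nonzero elements, so it does not change their product.
\<close>
lemma power_card_eq_same:
  fixes x :: "'a::{field, finite}"
  shows "x ^ CARD('a) = x"
proof (cases "x = 0")
  case False
  have "(\<Prod>y\<in>UNIV - {0}. y) = (\<Prod>y\<in>UNIV - {0}. x * y)"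
    by (rule prod.reindex_bij_witness[of _ "\<lambda>y. x * y" "\<lambda>y. y / x"]) (use False in auto)
  also have "\<dots> = x ^ (CARD('a) - 1) * (\<Prod>y\<in>UNIV - {0}. y)"
    by (simp add: prod.distrib card_Diff_singleton)
  finally have "x ^ (CARD('a) - 1) = 1" by simp
  then have "x ^ Suc (CARD('a) - 1) = x" by (simp only: power_Suc mult_1_right)
  moreover have "Suc (CARD('a) - 1) = CARD('a)" by simp
  ultimately show ?thesis by (simp only:)
qed simp

text \<open>
  The parameter \<open>field_type\<close> only makes the field visible to the locale, whose other
  parameters are numbers.
\<close>
locale finite_field_of_order =
  fixes p f :: nat and field_type :: "'a::{field, finite} itself"
  assumes p: "prime p" and f: "f > 0" and card: "CARD('a) = p ^ f"
begin

lemma CHAR: "CHAR('a) = p"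
  using CHAR_eq_of_card_prime_power[OF p card] .

lemma of_nat_p [simp]: "of_nat p = (0::'a)"
  using of_nat_CHAR[where ?'a = 'a] by (simp add: CHAR)

lemma of_nat_mod: "(of_nat (n mod p) :: 'a) = of_nat n"
proof -
  have "(of_nat n :: 'a) = of_nat (n div p * p + n mod p)" by simp
  also have "\<dots> = of_nat (n mod p)" by (simp only: of_nat_add of_nat_mult of_nat_p) simp
  finally show ?thesis ..
qed

lemma of_nat_inj: "inj_on (of_nat :: nat \<Rightarrow> 'a) {..<p}"
proof (rule linorder_inj_onI)
  fix m n assume "m < n" "m \<in> {..<p}" "n \<in> {..<p}"
  then show "(of_nat m :: 'a) \<noteq> of_nat n"
    using nat_dvd_not_less[of "n - m" p] by (simp add: of_nat_eq_iff_char_dvd CHAR)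
qed auto

lemma add_power_p: "((x::'a) + y) ^ p = x ^ p + y ^ p"
  using freshmans_dream[of x y] p by (simp add: CHAR)

lemma add_power_p_power: "((x::'a) + y) ^ (p ^ i) = x ^ (p ^ i) + y ^ (p ^ i)"
  by (induction i) (simp_all add: power_Suc2 power_mult add_power_p del: power_Suc)

lemma trace_add: "field_trace p f (x + y) = field_trace p f x + field_trace p f (y::'a)"
  by (simp add: field_trace_def add_power_p_power sum.distrib)

lemma sum_power_p: "finite A \<Longrightarrow> (\<Sum>i\<in>A. g i :: 'a) ^ p = (\<Sum>i\<in>A. g i ^ p)"
  by (induction A rule: finite_induct)
    (simp_all add: add_power_p prime_gt_0_nat[OF p])

lemma trace_power_p: "field_trace p f (x::'a) ^ p = field_trace p f x"
proof -
  have "field_trace p f x ^ p = (\<Sum>i<f. x ^ (p ^ Suc i))"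
    by (simp add: field_trace_def sum_power_p mult.commute flip: power_mult)
  also have "\<dots> = (\<Sum>i<f. x ^ (p ^ i)) + x ^ (p ^ f) - x"
    using sum.lessThan_Suc_shift[of "\<lambda>i. x ^ (p ^ i)" f] by (simp add: add.commute)
  also have "x ^ (p ^ f) = x"
    using power_card_eq_same[of x] by (simp add: card)
  finally show ?thesis by (simp add: field_trace_def)
qed

text \<open>
  The prime field consists of \<open>p\<close> roots of the polynomial \<open>X ^ p - X\<close>, which cannot have more.
\<close>
lemma power_p_fixed_points: "{x::'a. x ^ p = x} = of_nat ` {..<p}"
proof -
  define P :: "'a poly" where "P = monom 1 p + [:0, -1:]"
  have "degree P = p"
    unfolding P_def using prime_gt_1_nat[OF p] by (subst degree_add_eq_left) (auto simp: degree_monom_eq)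
  then have "P \<noteq> 0" using prime_gt_0_nat[OF p] by auto
  have roots: "{x. poly P x = 0} = {x. x ^ p = x}"
    by (auto simp: P_def poly_monom)
  have fixed: "(of_nat k :: 'a) ^ p = of_nat k" for k
    by (induction k) (simp_all add: add_power_p prime_gt_0_nat[OF p])
  have "of_nat ` {..<p} = {x::'a. x ^ p = x}"
  proof (rule card_seteq)
    have "card {x::'a. x ^ p = x} \<le> p"
      using card_poly_roots_bound[OF \<open>P \<noteq> 0\<close>] by (simp add: roots \<open>degree P = p\<close>)
    then show "card {x::'a. x ^ p = x} \<le> card (of_nat ` {..<p} :: 'a set)"
      by (simp add: card_image[OF of_nat_inj])
  qed (auto simp: fixed)
  then show ?thesis ..
qed

lemma prime_field_rep_of_nat: "prime_field_rep p (of_nat n :: 'a) = n mod p"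
  unfolding prime_field_rep_def
proof (rule the_equality)
  show "n mod p < p \<and> of_nat (n mod p) = (of_nat n :: 'a)"
    using prime_gt_0_nat[OF p] by (simp add: of_nat_mod)
  fix k assume "k < p \<and> of_nat k = (of_nat n :: 'a)"
  then show "k = n mod p"
    using inj_onD[OF of_nat_inj, of k "n mod p"] prime_gt_0_nat[OF p] by (simp add: of_nat_mod)
qed

lemma trace_of_natE:
  obtains k where "k < p" "field_trace p f (x::'a) = of_nat k"
  using trace_power_p[of x] power_p_fixed_points by blast

text \<open>
  As a polynomial the trace has degree \<open>p ^ (f - 1)\<close>, less than the number of field elements.
\<close>
lemma trace_nontrivial: "\<exists>x::'a. field_trace p f x \<noteq> 0"
proof (rule ccontr)
  assume trivial: "\<not> ?thesis"
  define P :: "'a poly" where "P = (\<Sum>i<f. monom 1 (p ^ i))"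
  have p1: "p > 1" using prime_gt_1_nat[OF p] .
  have "coeff P (p ^ (f - 1)) = (\<Sum>i<f. if i = f - 1 then 1 else 0)"
    using p1 by (simp add: P_def coeff_sum power_inject_exp)
  also have "\<dots> = 1" using f by simp
  finally have "P \<noteq> 0" by auto
  have "degree P \<le> p ^ (f - 1)"
    unfolding P_def
    by (intro degree_sum_le) (use p1 in \<open>auto simp: degree_monom_eq intro!: power_increasing\<close>)
  moreover have "{x. poly P x = 0} = UNIV"
    using trivial by (auto simp: P_def poly_sum poly_monom field_trace_def)
  ultimately have "p ^ f \<le> p ^ (f - 1)"
    using card_poly_roots_bound[OF \<open>P \<noteq> 0\<close>] by (simp add: card)
  moreover have "p ^ (f - 1) < p ^ f"
    by (rule power_strict_increasing) (use p1 f in auto)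
  ultimately show False by simp
qed

lemma zeta_power_p: "zeta p ^ p = 1"
  using prime_gt_0_nat[OF p] by (simp add: zeta_def flip: exp_of_nat_mult)

lemma zeta_power_mod: "zeta p ^ (n mod p) = zeta p ^ n"
proof -
  have "zeta p ^ n = zeta p ^ (p * (n div p) + n mod p)" by simp
  also have "\<dots> = zeta p ^ (n mod p)"
    by (simp only: power_add power_mult zeta_power_p) simp
  finally show ?thesis ..
qed

lemma zeta_cis: "zeta p ^ k = cis (2 * pi * real k / real p)"
proof -
  have "zeta p = cis (2 * pi / real p)"
    by (simp add: zeta_def cis_conv_exp mult_ac)
  then show ?thesis by (simp add: DeMoivre mult_ac)
qed

lemma zeta_power_neq_1:
  assumes "0 < k" "k < p"
  shows "zeta p ^ k \<noteq> 1"
proof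
  assume "zeta p ^ k = 1"
  then have "cis (2 * pi * real k / real p) = cis (2 * pi * real 0 / real p)"
    by (simp add: zeta_cis)
  from inj_onD[OF bij_betw_imp_inj_on[OF bij_betw_roots_unity[OF prime_gt_0_nat[OF p]]] this]
  have "k = 0" using assms by simp
  then show False using assms by simp
qed

lemma sum_zeta_powers: "(\<Sum>k<p. zeta p ^ k) = 0"
proof -
  have "zeta p \<noteq> 1" using zeta_power_neq_1[of 1] prime_gt_1_nat[OF p] by simp
  then show ?thesis using geometric_sum[of "zeta p" p] zeta_power_p by simp
qed

definition trace_character :: "'a \<Rightarrow> complex" where
  "trace_character x = zeta p ^ prime_field_rep p (field_trace p f x)"

lemma trace_character_eq: "field_trace p f x = of_nat n \<Longrightarrow> trace_character x = zeta p ^ n"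
  by (simp add: trace_character_def prime_field_rep_of_nat zeta_power_mod)

lemma additive_character_trace_character: "additive_character trace_character"
proof
  fix x y :: 'a
  obtain m where m: "field_trace p f x = of_nat m" using trace_of_natE .
  obtain n where n: "field_trace p f y = of_nat n" using trace_of_natE .
  have "field_trace p f (x + y) = of_nat (m + n)"
    by (simp add: trace_add m n)
  from trace_character_eq[OF this]
  show "trace_character (x + y) = trace_character x * trace_character y"
    using m n by (simp add: trace_character_eq power_add)
next
  have "field_trace p f (0::'a) = of_nat 0"
    unfolding field_trace_def of_nat_0
    by (intro sum.neutral ballI zero_power zero_less_power prime_gt_0_nat[OF p])
  then show "trace_character 0 = 1"
    by (simp only: trace_character_eq power_0)
next
  obtain x :: 'a where "field_trace p f x \<noteq> 0" using trace_nontrivial by blast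
  moreover obtain k where k: "k < p" "field_trace p f x = of_nat k" using trace_of_natE .
  ultimately have "0 < k" by (cases k) auto
  then have "trace_character x \<noteq> 1"
    using zeta_power_neq_1 k(1) trace_character_eq[OF k(2)] by simp
  then show "\<exists>x. trace_character x \<noteq> 1" ..
qed

sublocale additive_character trace_character
  by (rule additive_character_trace_character)

lemma kloosterman_eq_character_sum: "kloosterman p f b = kloosterman_sum b"
  by (simp add: kloosterman_def kloosterman_sum_def trace_character_def)

lemma two_nonzero:
  assumes "odd p"
  shows "(2::'a) \<noteq> 0"
proof
  assume "(2::'a) = 0"
  then have "CHAR('a) dvd 2"
    using of_nat_eq_0_iff_char_dvd[of 2, where ?'a = 'a] by simp
  then show False
    using assms prime_ge_2_nat[OF p] dvd_imp_le[of p 2] by (auto simp: CHAR)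
qed

section \<open>Singularity of the Kloosterman matrix\<close>

text \<open>
  Sorting the circle by \<open>\<alpha> = a\<^sup>2\<close> turns \<open>kloosterman_sum_add_squares\<close> into an expression of
  the matrix as a sum of products \<open>F \<alpha> x * F (4 - \<alpha>) y\<close>, one for each of the at most
  \<open>(q + 5) / 4\<close> values of \<open>\<alpha>\<close>. This number is less than \<open>(q - 1) / 2\<close> as soon as
  \<open>q > 7\<close>.
\<close>
lemma kloosterman_mat_singular:
  fixes s :: "nat \<Rightarrow> 'a"
  assumes odd: "odd p" and large: "11 \<le> p ^ f"
    and squares: "s ` {..<(p ^ f - 1) div 2} \<subseteq> nonzero_squares"
  shows "\<not> invertible_mat (kloosterman_mat p f s)"
proof -
  define m where "m = (p ^ f - 1) div 2"
  let ?S = "squared_abscissae :: 'a set"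
  note two = two_nonzero[OF odd]
  obtain \<epsilon> where \<epsilon>: "\<And>x y. x \<noteq> 0 \<Longrightarrow> y \<noteq> 0 \<Longrightarrow>
      kloosterman_sum (x ^ 2 + y ^ 2) = \<epsilon> * (\<Sum>(a, b)\<in>circle. trace_character (a * x) * trace_character (b * y))"
    using kloosterman_sum_add_squares[OF two] by blast
  have "\<forall>i\<in>{..<m}. \<exists>x. x \<noteq> 0 \<and> s i = x ^ 2"
    using squares by (auto simp: m_def nonzero_squares_def image_subset_iff)
  then obtain x where x: "\<And>i. i < m \<Longrightarrow> x i \<noteq> 0 \<and> s i = x i ^ 2"
    by (metis lessThan_iff)
  let ?F = "\<lambda>\<alpha> i. \<Sum>a\<in>square_roots \<alpha>. trace_character (a * x i)"
  have "kloosterman_mat p f s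
      = mat m m (\<lambda>(i, j). \<Sum>\<alpha>\<in>?S. (\<epsilon> * ?F \<alpha> i) * ?F (4 - \<alpha>) j)"
  proof (rule eq_matI)
    fix i j assume "i < dim_row (mat m m (\<lambda>(i, j). \<Sum>\<alpha>\<in>?S. (\<epsilon> * ?F \<alpha> i) * ?F (4 - \<alpha>) j))"
      "j < dim_col (mat m m (\<lambda>(i, j). \<Sum>\<alpha>\<in>?S. (\<epsilon> * ?F \<alpha> i) * ?F (4 - \<alpha>) j))"
    then have ij: "i < m" "j < m" by simp_all
    have "kloosterman_sum (s i + s j) = \<epsilon> * (\<Sum>\<alpha>\<in>?S. ?F \<alpha> i * ?F (4 - \<alpha>) j)"
      using \<epsilon>[of "x i" "x j"] x ij by (simp add: sum_circle sum_product)
    also have "\<dots> = (\<Sum>\<alpha>\<in>?S. (\<epsilon> * ?F \<alpha> i) * ?F (4 - \<alpha>) j)"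
      by (subst sum_distrib_left) (simp only: mult.assoc)
    finally show "kloosterman_mat p f s $$ (i, j)
        = mat m m (\<lambda>(i, j). \<Sum>\<alpha>\<in>?S. (\<epsilon> * ?F \<alpha> i) * ?F (4 - \<alpha>) j) $$ (i, j)"
      using ij by (simp add: kloosterman_mat_def Let_def m_def kloosterman_eq_character_sum)
  qed (simp_all add: kloosterman_mat_def Let_def m_def)
  moreover have "card ?S < m"
  proof -
    have "odd (p ^ f)" using odd by simp
    then have "p ^ f = 2 * m + 1"
      unfolding m_def by (auto elim!: oddE)
    then show ?thesis
      using card_squared_abscissae_le[OF two] large by (simp add: card)
  qed
  ultimately show ?thesis
    by (intro singular_if_sum_of_few_products[where S = ?S and n = m]) auto
qed

end

section \<open>Determinants over small prime fields\<close>

text \<open>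
  The Kloosterman sum over the integers modulo \<open>p\<close>, with the inverse of \<open>k\<close> written as
  \<open>k ^ (p - 2)\<close> so that it can be evaluated by arithmetic on natural numbers.
\<close>
definition kloosterman_mod :: "nat \<Rightarrow> nat \<Rightarrow> complex" where
  "kloosterman_mod p c = (\<Sum>k\<in>{1..<p}. zeta p ^ ((k + c * k ^ (p - 2)) mod p))"

lemma kloosterman_of_nat:
  assumes p: "prime p" and order: "CARD('a::{field, finite}) = p"
  shows "kloosterman p 1 (of_nat c :: 'a) = kloosterman_mod p c"
    and "bij_betw of_nat {1..<p} (UNIV - {0} :: 'a set)"
proof -
  interpret finite_field_of_order p 1 "TYPE('a)"
    by unfold_locales (use p order in auto)
  have "of_nat ` {..<p} = (UNIV :: 'a set)"
    by (rule card_seteq) (simp_all add: card_image[OF of_nat_inj] order)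
  moreover have "{1..<p} = {..<p} - {0}" by auto
  moreover have "of_nat ` ({..<p} - {0}) = (of_nat ` {..<p} - of_nat ` {0} :: 'a set)"
    by (rule inj_on_image_set_diff[OF of_nat_inj]) (use prime_gt_0_nat[OF p] in auto)
  ultimately show bij: "bij_betw of_nat {1..<p} (UNIV - {0} :: 'a set)"
    using inj_on_subset[OF of_nat_inj, of "{1..<p}"] by (simp add: bij_betw_def)
  have inverse: "(of_nat k :: 'a) ^ (p - 2) = 1 / of_nat k" if "k \<in> {1..<p}" for k
  proof -
    have "(of_nat k :: 'a) \<noteq> 0" using bij_betwE[OF bij] that by auto
    moreover have "p = Suc (Suc (p - 2))" using prime_ge_2_nat[OF p] by simp
    then have "(of_nat k :: 'a) ^ (p - 2) * of_nat k * of_nat k = of_nat k"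
      using power_card_eq_same[of "of_nat k :: 'a"] order
      by (metis power_Suc mult.commute mult.assoc)
    ultimately show ?thesis by (simp add: field_simps)
  qed
  have "kloosterman p 1 (of_nat c :: 'a)
      = (\<Sum>k\<in>{1..<p}. zeta p ^ prime_field_rep p (of_nat k + of_nat c / of_nat k :: 'a))"
    unfolding kloosterman_def field_trace_def
    by (subst sum.reindex_bij_betw[OF bij, symmetric]) simp
  also have "\<dots> = kloosterman_mod p c"
    unfolding kloosterman_mod_def
  proof (intro sum.cong refl)
    fix k assume "k \<in> {1..<p}"
    from inverse[OF this]
    have "of_nat k + of_nat c / of_nat k = (of_nat (k + c * k ^ (p - 2)) :: 'a)" by simp
    then show "zeta p ^ prime_field_rep p (of_nat k + of_nat c / of_nat k :: 'a)
        = zeta p ^ ((k + c * k ^ (p - 2)) mod p)"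
      by (simp only: prime_field_rep_of_nat)
  qed
  finally show "kloosterman p 1 (of_nat c :: 'a) = kloosterman_mod p c" .
qed

text \<open>
  The enumeration of the squares is arbitrary, so all that is known of the integers \<open>k i\<close>
  representing it is that they enumerate the quadratic residues modulo \<open>p\<close> in some order.
\<close>
lemma kloosterman_mat_prime_field:
  fixes s :: "nat \<Rightarrow> 'a::{field, finite}"
  assumes p: "prime p" and order: "CARD('a) = p"
    and s: "bij_betw s {..<(p - 1) div 2} nonzero_squares"
  obtains k where "inj_on k {..<(p - 1) div 2}"
    and "\<And>i. i < (p - 1) div 2 \<Longrightarrow> k i \<in> (\<lambda>r. r ^ 2 mod p) ` {1..<p}"
    and "kloosterman_mat p 1 s
      = mat ((p - 1) div 2) ((p - 1) div 2) (\<lambda>(i, j). kloosterman_mod p (k i + k j))"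
proof -
  interpret finite_field_of_order p 1 "TYPE('a)"
    by unfold_locales (use p order in auto)
  define m where "m = (p - 1) div 2"
  have "\<exists>k. k \<in> (\<lambda>r. r ^ 2 mod p) ` {1..<p} \<and> s i = of_nat k" if "i < m" for i
  proof -
    have "s i \<in> nonzero_squares" using bij_betwE[OF s] that by (simp add: m_def)
    then obtain x where "x \<noteq> 0" "s i = x ^ 2" by (auto simp: nonzero_squares_def)
    moreover from this obtain r where "r \<in> {1..<p}" "x = of_nat r"
      using bij_betw_imp_surj_on[OF kloosterman_of_nat(2)[OF p order]] by blast
    ultimately have "s i = of_nat (r ^ 2 mod p)" by (simp add: of_nat_mod)
    then show ?thesis using \<open>r \<in> {1..<p}\<close> by blast
  qed
  then obtain k where k: "\<And>i. i < m \<Longrightarrow> k i \<in> (\<lambda>r. r ^ 2 mod p) ` {1..<p} \<and> s i = of_nat (k i)"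
    by metis
  have "inj_on k {..<m}"
    using k bij_betw_imp_inj_on[OF s] unfolding inj_on_def m_def by (metis lessThan_iff)
  moreover have "kloosterman_mat p 1 s = mat m m (\<lambda>(i, j). kloosterman_mod p (k i + k j))"
  proof -
    have "kloosterman p 1 (s i + s j) = kloosterman_mod p (k i + k j)" if "i < m" "j < m" for i j
      using that k kloosterman_of_nat(1)[OF p order, of "k i + k j"] by simp
    moreover have "kloosterman_mat p 1 s = mat m m (\<lambda>(i, j). kloosterman p 1 (s i + s j))"
      by (simp only: kloosterman_mat_def Let_def power_one_right m_def)
    ultimately show ?thesis by (auto intro!: eq_matI)
  qed
  ultimately show thesis using that k by (simp add: m_def)
qed

lemma det_mat_1: "det (mat 1 1 g) = g (0, 0)"
  by (subst det_single) auto

lemma det_mat_2: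
  "det (mat 2 2 g) = g (0, 0) * g (1, 1) - g (0, 1) * (g (1, 0) :: 'a::comm_ring_1)"
  by (subst laplace_expansion_row[of _ 2 0])
    (auto simp: cofactor_def mat_delete_def det_single numeral_2_eq_2)

lemma det_mat_3:
  fixes g :: "nat \<times> nat \<Rightarrow> 'a::comm_ring_1"
  shows "det (mat 3 3 g) = g (0, 0) * (g (1, 1) * g (2, 2) - g (1, 2) * g (2, 1))
    - g (0, 1) * (g (1, 0) * g (2, 2) - g (1, 2) * g (2, 0))
    + g (0, 2) * (g (1, 0) * g (2, 1) - g (1, 1) * g (2, 0))"
proof -
  have "mat_delete (mat 3 3 g) 0 j
      = mat 2 2 (\<lambda>(i, k). g (Suc i, if k < j then k else Suc k))" for j
    by (rule eq_matI) (auto simp: mat_delete_def)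
  note minor = this
  have "det (mat 3 3 g) = (\<Sum>j<3. mat 3 3 g $$ (0, j) * cofactor (mat 3 3 g) 0 j)"
    by (rule laplace_expansion_row) auto
  moreover have "{..<3} = {0, 1, 2::nat}" by auto
  ultimately show ?thesis
    by (simp add: cofactor_def minor det_mat_2) (simp add: numeral_2_eq_2 algebra_simps)
qed

lemma det_kloosterman_mod_3:
  assumes "k 0 \<in> (\<lambda>r::nat. r ^ 2 mod 3) ` {1..<3}"
  shows "det (mat 1 1 (\<lambda>(i, j). kloosterman_mod 3 (k i + k j))) = 2"
proof -
  have range: "{Suc 0..<3} = {1, 2::nat}" by auto
  then have "k 0 = 1" using assms by auto
  then show ?thesis
    unfolding det_mat_1 by (simp add: kloosterman_mod_def range)
qed

lemma det_kloosterman_mod_5: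
  fixes k :: "nat \<Rightarrow> nat"
  assumes zeta: "zeta 5 ^ 5 = 1" "(\<Sum>i<5. zeta 5 ^ i) = 0"
    and inj: "inj_on k {..<2}" and k: "\<And>i. i < 2 \<Longrightarrow> k i \<in> (\<lambda>r. r ^ 2 mod 5) ` {1..<5}"
  shows "det (mat 2 2 (\<lambda>(i, j). kloosterman_mod 5 (k i + k j))) = -5"
proof -
  have range: "{Suc 0..<5} = {1, 2, 3, 4::nat}" by auto
  define z where "z = zeta 5"
  have z: "z ^ 5 = 1" "1 + z + z ^ 2 + z ^ 3 + z ^ 4 = 0"
    using zeta by (simp_all add: z_def eval_nat_numeral)
  have entries: "kloosterman_mod 5 2 = 2 * z ^ 2 + 2 * z ^ 3" "kloosterman_mod 5 8 = 2 * z + 2 * z ^ 4"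
    "kloosterman_mod 5 5 = z + z ^ 2 + z ^ 3 + z ^ 4"
    by (simp_all add: kloosterman_mod_def range z_def)
  have "(2 * z ^ 2 + 2 * z ^ 3) * (2 * z + 2 * z ^ 4) - (z + z ^ 2 + z ^ 3 + z ^ 4) ^ 2 = -5"
    using z by Groebner_Basis.algebra
  then have val: "kloosterman_mod 5 2 * kloosterman_mod 5 8 - kloosterman_mod 5 5 ^ 2 = -5"
    by (simp only: entries)
  have "k 0 = 1 \<and> k 1 = 4 \<or> k 0 = 4 \<and> k 1 = 1"
    using k[of 0] k[of 1] inj_on_eq_iff[OF inj, of 0 1] by (auto simp: range)
  then show ?thesis
    unfolding det_mat_2 using val
    by (auto simp: power2_eq_square mult.commute simp del: One_nat_def)
qed

text \<open>
  All entries lie in the real cubic subfield of the seventh cyclotomic field, which is spanned by the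
  conjugates \<open>c1\<close>, \<open>c2\<close>, \<open>c3\<close> of \<open>\<zeta> + 1 / \<zeta>\<close>. Their multiplication table
  reduces the determinant to a number.
\<close>
lemma det_kloosterman_mod_7:
  fixes k :: "nat \<Rightarrow> nat"
  assumes zeta: "zeta 7 ^ 7 = 1" "(\<Sum>i<7. zeta 7 ^ i) = 0"
    and inj: "inj_on k {..<3}" and k: "\<And>i. i < 3 \<Longrightarrow> k i \<in> (\<lambda>r. r ^ 2 mod 7) ` {1..<7}"
  shows "det (mat 3 3 (\<lambda>(i, j). kloosterman_mod 7 (k i + k j))) = 49"
proof -
  let ?K = "kloosterman_mod 7"
  have range: "{Suc 0..<7} = {1, 2, 3, 4, 5, 6::nat}" by auto
  define z where "z = zeta 7"
  define c1 where "c1 = z + z ^ 6"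
  define c2 where "c2 = z ^ 2 + z ^ 5"
  define c3 where "c3 = z ^ 3 + z ^ 4"
  have z: "z ^ 7 = 1" "1 + z + z ^ 2 + z ^ 3 + z ^ 4 + z ^ 5 + z ^ 6 = 0"
    using zeta by (simp_all add: z_def eval_nat_numeral)
  have "c1 + c2 + c3 + 1 = 0"
    unfolding c1_def c2_def c3_def using z(2) by (simp add: algebra_simps)
  then have c3: "c3 = - 1 - c1 - c2"
    by Groebner_Basis.algebra
  have squares: "c1 * c1 = 2 + c2" "c1 * c2 = c1 + c3" "c2 * c2 = 2 + c3"
    unfolding c1_def c2_def c3_def using z(1) by Groebner_Basis.algebra+
  have entries: "kloosterman_mod 7 8 = c2 + 2 * c1" "kloosterman_mod 7 2 = c1 + 2 * c3"
    "kloosterman_mod 7 4 = c3 + 2 * c2" "kloosterman_mod 7 3 = 2 + 2 * c3"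
    "kloosterman_mod 7 5 = 2 + 2 * c1" "kloosterman_mod 7 6 = 2 + 2 * c2"
    by (simp_all add: kloosterman_mod_def range c1_def c2_def c3_def flip: z_def)
  have "(c1 + 2 * c3) * (c3 + 2 * c2) * (c2 + 2 * c1)
      + 2 * (2 + 2 * c1) * (2 + 2 * c2) * (2 + 2 * c3)
      - (c1 + 2 * c3) * (2 + 2 * c2) ^ 2 - (c3 + 2 * c2) * (2 + 2 * c1) ^ 2
      - (c2 + 2 * c1) * (2 + 2 * c3) ^ 2 = 49"
    using squares unfolding c3 by Groebner_Basis.algebra
  \<comment> \<open>The determinant for the order 1, 2, 4 of the residues, in a form that every reordering of them preserves.\<close>
  then have val: "?K 2 * ?K 4 * ?K 8 + 2 * ?K 5 * ?K 6 * ?K 3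
      - ?K 2 * ?K 6 ^ 2 - ?K 4 * ?K 5 ^ 2 - ?K 8 * ?K 3 ^ 2 = 49"
    by (simp only: entries)
  have "k 0 \<in> {1, 2, 4}" "k 1 \<in> {1, 2, 4}" "k 2 \<in> {1, 2, 4}"
    using k[of 0] k[of 1] k[of 2] by (auto simp: range)
  moreover have "k 0 \<noteq> k 1" "k 0 \<noteq> k 2" "k 1 \<noteq> k 2"
    using inj_on_eq_iff[OF inj, of 0 1] inj_on_eq_iff[OF inj, of 0 2] inj_on_eq_iff[OF inj, of 1 2]
    by auto
  ultimately consider "k 0 = 1" "k 1 = 2" "k 2 = 4" | "k 0 = 1" "k 1 = 4" "k 2 = 2"
    | "k 0 = 2" "k 1 = 1" "k 2 = 4" | "k 0 = 2" "k 1 = 4" "k 2 = 1"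
    | "k 0 = 4" "k 1 = 1" "k 2 = 2" | "k 0 = 4" "k 1 = 2" "k 2 = 1"
    by auto
  then show ?thesis
    unfolding det_mat_3 using val
    by cases (simp_all add: algebra_simps power2_eq_square del: One_nat_def)
qed

lemma prime_power_eq_prime:
  fixes p q f :: nat
  assumes "prime p" "prime q" "p ^ f = q"
  shows "p = q" "f = 1"
proof -
  have "f > 0" using assms by (cases f) auto
  then have "p dvd q" using assms(3) by auto
  then show "p = q" using assms(1,2) primes_dvd_imp_eq by blast
  then have "p ^ f = p ^ 1" using assms(3) by simp
  then show "f = 1" using prime_gt_1_nat[OF assms(1)] power_inject_exp by blast
qed

theorem theorem1p2:
  fixes p f q :: nat and s :: "nat \<Rightarrow> 'a::{field, finite}"
  assumes "prime p" and "odd p" and "f > 0" and "q = p ^ f"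
    and "CARD('a) = q"
    and "bij_betw s {..<(q - 1) div 2} nonzero_squares"
  shows "(q \<ge> 11 \<longrightarrow> \<not> invertible_mat (kloosterman_mat p f s)) \<and>
    (q = 3 \<longrightarrow> Determinant.det (kloosterman_mat p f s) = 2) \<and>
    (q = 5 \<longrightarrow> Determinant.det (kloosterman_mat p f s) = -5) \<and>
    (q = 7 \<longrightarrow> Determinant.det (kloosterman_mat p f s) = 49)"
proof (intro conjI impI)
  interpret finite_field_of_order p f "TYPE('a)"
    by unfold_locales (use assms in auto)
  show "\<not> invertible_mat (kloosterman_mat p f s)" if "q \<ge> 11"
    using that assms kloosterman_mat_singular[of s] by (simp add: bij_betw_imp_surj_on)
  have prime_field: "p = q" "f = 1" if "prime q"
    using prime_power_eq_prime[OF \<open>prime p\<close> that] assms(4) by auto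
  have zeta: "zeta q ^ q = 1" "(\<Sum>i<q. zeta q ^ i) = 0" if "prime q"
    using zeta_power_p sum_zeta_powers prime_field[OF that] by auto
  have enum: "\<exists>k. inj_on k {..<(q - 1) div 2}
      \<and> (\<forall>i<(q - 1) div 2. k i \<in> (\<lambda>r. r ^ 2 mod q) ` {1..<q})
      \<and> kloosterman_mat p f s
        = mat ((q - 1) div 2) ((q - 1) div 2) (\<lambda>(i, j). kloosterman_mod q (k i + k j))"
    if "prime q"
    using kloosterman_mat_prime_field[OF that assms(5,6)] prime_field[OF that] by metis
  show "det (kloosterman_mat p f s) = 2" if q: "q = 3"
  proof -
    have q_prime: "prime q" using q by simp
    show ?thesis using enum[OF q_prime] det_kloosterman_mod_3 unfolding q by auto
  qed
  show "det (kloosterman_mat p f s) = -5" if q: "q = 5"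
  proof -
    have q_prime: "prime q" using q by simp
    show ?thesis using enum[OF q_prime] zeta[OF q_prime] det_kloosterman_mod_5 unfolding q by auto
  qed
  show "det (kloosterman_mat p f s) = 49" if q: "q = 7"
  proof -
    have q_prime: "prime q" using q by simp
    show ?thesis using enum[OF q_prime] zeta[OF q_prime] det_kloosterman_mod_7 unfolding q by auto
  qed
qed

end
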